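(* Let $1<p,q<\infty$ and let $a,b$ be weight functions on $\mathbb R^n$ with $a\in L^1(\mathbb R^n)$ and $b\in L^1(\mathbb R^n)$. Then: (a) The continuous embedding $W(L^p(\mathbb R^n),L^q(\mathbb R^n))\hookrightarrow W(L_a^{p)}(\mathbb R^n),L_b^{q)}(\mathbb R^n))$ holds; in addition, there is a constant $C>0$ such that $\|f\|_{W(L_a^{p)}(\mathbb R^n),L_b^{q)}(\mathbb R^n))}\le C\,\|f\|_{W(L^p(\mathbb R^n),L^q(\mathbb R^n))}$ for all $f\in W(L^p(\mathbb R^n),L^q(\mathbb R^n))$. (b) For arbitrary $\varepsilon$ and $\eta$ with $0<\varepsilon\le p-1$ and $0<\eta\le q-1$, the continuous embedding $W(L_a^{p)}(\mathbb R^n),L_b^{q)}(\mathbb R^n))\hookrightarrow W\big(L^{p-\varepsilon}(\mathbb R^n,a^{\varepsilon/p}),L^{q-\eta}(\mathbb R^n,b^{\eta/q})\big)$ holds.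
   Context: A weight function on $\mathbb R^n$ is a measurable, locally integrable real-valued function that is positive (it may vanish only on a set of measure zero). For $1\le s<\infty$ and a weight $\omega$, $L^s(\mathbb R^n,\omega)$ has norm $\|f\|_{L^s(\mathbb R^n,\omega)}=\left(\int_{\mathbb R^n}|f(x)|^s\omega(x)\,dx\right)^{1/s}$. For $1<p<\infty$ and a weight $a$, the generalized grand Lebesgue space $L_a^{p)}(\mathbb R^n)$ consists of the (classes of) measurable $f$ with $$\|f\|_{L_a^{p)}(\mathbb R^n)}=\sup_{0<\varepsilon\le p-1}\varepsilon\left(\int_{\mathbb R^n}|f(x)|^{p-\varepsilon}a(x)^{\varepsilon/p}\,dx\right)^{1/(p-\varepsilon)}<\infty .$$ Fix a compact set $Q\subset\mathbb R^n$ with nonempty interior. Let each of $B$ and $C$ be a classical Lebesgue space $L^s(\mathbb R^n)$ with $1\le s<\infty$, a weighted Lebesgue space $L^s(\mathbb R^n,\omega)$ with $1\le s<\infty$ and $\omega$ a weight, or a generalized grand Lebesgue space $L_a^{p)}(\mathbb R^n)$ with $1<p<\infty$ and $a$ a weight. The Wiener amalgam space $W(B,C)$ consists of all (classes of) measurable $f:\mathbb R^n\to\mathbb C$ such that $f\chi_K\in B$ for every compact $K\subset\mathbb R^n$ and such that the control function $x\mapsto\|f\chi_{Q+x}\|_B$ belongs to $C$. Its norm is $\|f\|_{W(B,C)}=\big\|\,\|f\chi_{Q+x}\|_B\,\big\|_C$ (outer norm taken in the variable $x$). The case $B=L_a^{p)}$, $C=L_b^{q)}$ is the generalized grand Wiener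 amalgam space. The symbol $\hookrightarrow$ denotes continuous inclusion. *)

theory Defs
  imports "HOL-Analysis.Analysis"
begin

definition weight :: "('a::euclidean_space \<Rightarrow> real) \<Rightarrow> bool" where
  "weight w \<longleftrightarrow>
     w \<in> borel_measurable lebesgue \<and>
     (\<forall>K. compact K \<longrightarrow> set_integrable lebesgue K w) \<and>
     (\<forall>x. 0 \<le> w x) \<and> (AE x in lebesgue. 0 < w x)"

text \<open>
  Norms take values in \<^typ>\<open>ennreal\<close>, the value \<open>\<infinity>\<close> marking functions
  outside the space. Elements of the spaces are represented by functions rather than by classes
  modulo equality almost everywhere; all norms below depend on the class only.
\<close>

definition ennreal_root :: "real \<Rightarrow> ennreal \<Rightarrow> ennreal" where
  "ennreal_root s x = (if x = \<infinity> then \<infinity> else ennreal (enn2real x powr (1 / s)))"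

definition lebesgue_norm :: "real \<Rightarrow> ('a::euclidean_space \<Rightarrow> complex) \<Rightarrow> ennreal" where
  "lebesgue_norm s f = ennreal_root s (\<integral>\<^sup>+x. ennreal (norm (f x) powr s) \<partial>lebesgue)"

definition weighted_lebesgue_norm ::
    "real \<Rightarrow> ('a::euclidean_space \<Rightarrow> real) \<Rightarrow> ('a \<Rightarrow> complex) \<Rightarrow> ennreal" where
  "weighted_lebesgue_norm s w f =
     ennreal_root s (\<integral>\<^sup>+x. ennreal (norm (f x) powr s * w x) \<partial>lebesgue)"

definition grand_lebesgue_norm ::
    "real \<Rightarrow> ('a::euclidean_space \<Rightarrow> real) \<Rightarrow> ('a \<Rightarrow> complex) \<Rightarrow> ennreal" where
  "grand_lebesgue_norm p a f =
     (SUP \<epsilon>\<in>{0<..p - 1}. ennreal \<epsilon> *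
        ennreal_root (p - \<epsilon>)
          (\<integral>\<^sup>+x. ennreal (norm (f x) powr (p - \<epsilon>) * a x powr (\<epsilon> / p)) \<partial>lebesgue))"

text \<open>
  The spaces admitted as components of a Wiener amalgam space. The constraints on the parameters
  (\<open>1 \<le> s\<close>, \<open>1 < p\<close>, \<open>w\<close> and \<open>a\<close> weights) are
  not part of the type.
\<close>

datatype 'a function_space =
    Lebesgue real
  | Weighted_Lebesgue real "'a \<Rightarrow> real"
  | Grand_Lebesgue real "'a \<Rightarrow> real"

fun space_norm :: "'a::euclidean_space function_space \<Rightarrow> ('a \<Rightarrow> complex) \<Rightarrow> ennreal" where
  "space_norm (Lebesgue s) f = lebesgue_norm s f"
| "space_norm (Weighted_Lebesgue s w) f = weighted_lebesgue_norm s w f"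
| "space_norm (Grand_Lebesgue p a) f = grand_lebesgue_norm p a f"

definition space_set :: "'a::euclidean_space function_space \<Rightarrow> ('a \<Rightarrow> complex) set" where
  "space_set B = {f. f \<in> borel_measurable lebesgue \<and> space_norm B f < \<infinity>}"

definition cutoff :: "('a \<Rightarrow> complex) \<Rightarrow> 'a set \<Rightarrow> 'a \<Rightarrow> complex" where
  "cutoff f K = (\<lambda>x. f x * indicator K x)"

text \<open>
  The conversion \<^const>\<open>enn2real\<close> sends \<open>\<infinity>\<close> to \<open>0\<close>, so the
  control function and the amalgam norm are meaningful only for functions that are locally in
  \<open>B\<close>; this is required explicitly in the definition of the amalgam space.
\<close>

definition control ::
    "'a::euclidean_space set \<Rightarrow> 'a function_space \<Rightarrow> ('a \<Rightarrow> complex) \<Rightarrow> 'a \<Rightarrow> complex" where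
  "control Q B f = (\<lambda>x. of_real (enn2real (space_norm B (cutoff f ((\<lambda>y. y + x) ` Q)))))"

definition wiener_norm ::
    "'a::euclidean_space set \<Rightarrow> 'a function_space \<Rightarrow> 'a function_space \<Rightarrow> ('a \<Rightarrow> complex) \<Rightarrow> ennreal" where
  "wiener_norm Q B C f = space_norm C (control Q B f)"

definition wiener_space ::
    "'a::euclidean_space set \<Rightarrow> 'a function_space \<Rightarrow> 'a function_space \<Rightarrow> ('a \<Rightarrow> complex) set" where
  "wiener_space Q B C =
     {f. f \<in> borel_measurable lebesgue \<and>
         (\<forall>K. compact K \<longrightarrow> cutoff f K \<in> space_set B) \<and>
         control Q B f \<in> space_set C}"

text \<open>
  Inclusion of \<open>X\<close> in \<open>Y\<close> such that the inclusion map is continuous for the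
  distances given by the norms \<open>NX\<close> and \<open>NY\<close>.
\<close>

definition continuous_inclusion ::
    "('a \<Rightarrow> complex) set \<Rightarrow> (('a \<Rightarrow> complex) \<Rightarrow> ennreal) \<Rightarrow>
     ('a \<Rightarrow> complex) set \<Rightarrow> (('a \<Rightarrow> complex) \<Rightarrow> ennreal) \<Rightarrow> bool" where
  "continuous_inclusion X NX Y NY \<longleftrightarrow>
     X \<subseteq> Y \<and>
     (\<forall>f\<in>X. \<forall>e>0. \<exists>d>0. \<forall>g\<in>X.
        NX (\<lambda>x. g x - f x) < ennreal d \<longrightarrow> NY (\<lambda>x. g x - f x) < ennreal e)"

definition wiener_embedding ::
    "'a::euclidean_space set \<Rightarrow> 'a function_space \<Rightarrow> 'a function_space \<Rightarrow>
     'a function_space \<Rightarrow> 'a function_space \<Rightarrow> bool" where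
  "wiener_embedding Q B C B' C' \<longleftrightarrow>
     continuous_inclusion (wiener_space Q B C) (wiener_norm Q B C)
       (wiener_space Q B' C') (wiener_norm Q B' C')"

end

theory Submission
  imports Defs
begin

text \<open>
  An inequality \<open>\<parallel>f\<parallel>\<^sub>B\<^sub>' \<le> c \<parallel>f\<parallel>\<^sub>B\<close> for the local components passes pointwise to the control
  functions, and an inequality \<open>\<parallel>h\<parallel>\<^sub>C\<^sub>' \<le> d \<parallel>h\<parallel>\<^sub>C\<close> for the global components then gives the embedding
  of amalgams with constant \<open>c d\<close>. In (a) both inequalities come from the bound of the
  \<open>\<epsilon>\<close>-members of the grand norm by the Lebesgue norm, uniformly in \<open>\<epsilon>\<close> since the weight is
  integrable; in (b) the weighted norm is a single member of the supremum. Control functions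
  are measurable by Tonelli's theorem.
\<close>

section \<open>Roots of extended nonnegative reals\<close>

text \<open>Lets norm bounds be traded for bounds on the integrals under the root, to which Fatou's
  lemma and pointwise estimates apply. At \<open>x = \<infinity>\<close> both sides are false
  because \<open>M\<close> is a real number.\<close>

lemma ennreal_root_le_iff:
  assumes "0 < s" and "0 \<le> M"
  shows "ennreal_root s x \<le> ennreal M \<longleftrightarrow> x \<le> ennreal (M powr s)"
proof (cases x)
  case (real r)
  have "r powr (1 / s) \<le> M \<longleftrightarrow> r \<le> M powr s"
  proof
    assume "r powr (1 / s) \<le> M"
    then have "(r powr (1 / s)) powr s \<le> M powr s"
      using assms by (intro powr_mono2) auto
    then show "r \<le> M powr s" using assms real by (simp add: powr_powr)
  next
    assume "r \<le> M powr s"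
    then have "r powr (1 / s) \<le> (M powr s) powr (1 / s)"
      using assms real by (intro powr_mono2) auto
    then show "r powr (1 / s) \<le> M" using assms by (simp add: powr_powr)
  qed
  then show ?thesis using real assms by (simp add: ennreal_root_def)
next
  case top
  then show ?thesis by (simp add: ennreal_root_def top_unique)
qed

lemma ennreal_root_mono:
  assumes "0 < s" and "x \<le> y"
  shows "ennreal_root s x \<le> ennreal_root s y"
proof (cases "y = \<infinity>")
  case False
  then have "x \<noteq> \<infinity>" using assms by (auto simp: top_unique)
  then show ?thesis using False assms
    by (auto simp: ennreal_root_def less_top intro!: ennreal_leI powr_mono2 enn2real_mono)
qed (simp add: ennreal_root_def)

lemma ennreal_root_cmult:
  assumes "0 < s" and "0 < c"
  shows "ennreal_root s (ennreal (c powr s) * x) = ennreal c * ennreal_root s x"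
proof (cases x)
  case (real r)
  then show ?thesis using assms
    by (simp add: ennreal_root_def ennreal_mult[symmetric] powr_mult powr_powr)
next
  case top
  then show ?thesis using assms
    by (simp add: ennreal_root_def ennreal_mult_top)
qed

text \<open>With \<open>z\<close> the larger of the two terms, \<open>x + y\<close> is at most
  \<open>2 * z\<close>, hence at most \<open>2 powr s * z\<close> as \<open>1 \<le> s\<close>; the
  root of the latter is \<open>2\<close> times the root of \<open>z\<close>. The crude factor
  suffices wherever only finiteness of a norm is at stake.\<close>

lemma ennreal_root_add_le:
  assumes "1 \<le> s"
  shows "ennreal_root s (x + y) \<le> 2 * (ennreal_root s x + ennreal_root s y)"
proof -
  define z where "z = max x y"
  have "x + y \<le> z + z" unfolding z_def by (intro add_mono) auto
  also have "\<dots> = ennreal 2 * z" by (simp add: mult_2)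
  also have "\<dots> \<le> ennreal (2 powr s) * z"
    using powr_mono[of 1 s 2] assms by (intro mult_right_mono ennreal_leI) auto
  finally have "ennreal_root s (x + y) \<le> ennreal_root s (ennreal (2 powr s) * z)"
    using assms by (intro ennreal_root_mono) auto
  also have "\<dots> = 2 * ennreal_root s z"
    using assms by (subst ennreal_root_cmult) auto
  also have "\<dots> \<le> 2 * (ennreal_root s x + ennreal_root s y)"
    by (intro mult_left_mono) (auto simp: z_def max_def)
  finally show ?thesis .
qed

lemma measurable_ennreal_root [measurable]: "ennreal_root s \<in> borel_measurable borel"
  unfolding ennreal_root_def[abs_def] by measurable

section \<open>Weighted norms as the common form of all three norms; domination and quasi-triangle
  inequality\<close>

lemma lebesgue_norm_eq_weighted: "lebesgue_norm s f = weighted_lebesgue_norm s (\<lambda>_. 1) f"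
  by (simp add: lebesgue_norm_def weighted_lebesgue_norm_def)

lemma grand_lebesgue_norm_eq_weighted:
  "grand_lebesgue_norm p a f =
     (SUP \<epsilon>\<in>{0<..p - 1}. ennreal \<epsilon> *
        weighted_lebesgue_norm (p - \<epsilon>) (\<lambda>x. a x powr (\<epsilon> / p)) f)"
  by (simp add: grand_lebesgue_norm_def weighted_lebesgue_norm_def)

lemma weighted_lebesgue_norm_le_cmult:
  fixes f h :: "'a::euclidean_space \<Rightarrow> complex"
  assumes [measurable]: "f \<in> borel_measurable lebesgue" "w \<in> borel_measurable lebesgue"
    and "0 < s" "0 < c" and w: "\<And>x. 0 \<le> w x"
    and le: "\<And>x. norm (h x) \<le> c * norm (f x)"
  shows "weighted_lebesgue_norm s w h \<le> ennreal c * weighted_lebesgue_norm s w f"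
proof -
  have "norm (h x) powr s * w x \<le> c powr s * (norm (f x) powr s * w x)" for x
  proof -
    have "norm (h x) powr s \<le> (c * norm (f x)) powr s"
      using le assms by (intro powr_mono2) auto
    then show ?thesis
      using mult_right_mono[OF _ w[of x]] assms by (simp add: powr_mult flip: mult.assoc)
  qed
  then have "(\<integral>\<^sup>+x. ennreal (norm (h x) powr s * w x) \<partial>lebesgue)
      \<le> (\<integral>\<^sup>+x. ennreal (c powr s) * ennreal (norm (f x) powr s * w x) \<partial>lebesgue)"
    using w by (intro nn_integral_mono) (auto simp flip: ennreal_mult intro!: ennreal_leI)
  also have "\<dots> = ennreal (c powr s) * (\<integral>\<^sup>+x. ennreal (norm (f x) powr s * w x) \<partial>lebesgue)"
    by (intro nn_integral_cmult) measurable
  finally show ?thesis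
    unfolding weighted_lebesgue_norm_def
    using assms by (subst ennreal_root_cmult[symmetric]) (auto intro: ennreal_root_mono)
qed

text \<open>A substitute for Minkowski's inequality. One factor 2 comes from the pointwise estimate
  of the difference, the other from \<open>ennreal_root_add_le\<close>.\<close>

lemma weighted_lebesgue_norm_diff_le:
  fixes f g :: "'a::euclidean_space \<Rightarrow> complex"
  assumes [measurable]: "f \<in> borel_measurable lebesgue" "g \<in> borel_measurable lebesgue"
      "w \<in> borel_measurable lebesgue"
    and "1 \<le> s" and w: "\<And>x. 0 \<le> w x"
  shows "weighted_lebesgue_norm s w (\<lambda>x. g x - f x)
    \<le> 4 * (weighted_lebesgue_norm s w g + weighted_lebesgue_norm s w f)"
proof -
  let ?I = "\<lambda>f. (\<integral>\<^sup>+x. ennreal (norm (f x) powr s * w x) \<partial>lebesgue)"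
  have "norm (g x - f x) powr s * w x
      \<le> 2 powr s * (norm (g x) powr s * w x + norm (f x) powr s * w x)" for x
  proof -
    have "norm (g x - f x) \<le> 2 * max (norm (g x)) (norm (f x))"
      using norm_triangle_ineq4[of "g x" "f x"] by linarith
    then have "norm (g x - f x) powr s \<le> (2 * max (norm (g x)) (norm (f x))) powr s"
      using assms by (intro powr_mono2) auto
    also have "\<dots> \<le> 2 powr s * (norm (g x) powr s + norm (f x) powr s)"
      by (subst powr_mult) (auto simp: max_def)
    finally show ?thesis
      using mult_right_mono[OF _ w[of x]] by (fastforce simp: algebra_simps)
  qed
  then have "?I (\<lambda>x. g x - f x) \<le> (\<integral>\<^sup>+x. ennreal (2 powr s) *
      (ennreal (norm (g x) powr s * w x) + ennreal (norm (f x) powr s * w x)) \<partial>lebesgue)"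
    using w by (intro nn_integral_mono)
      (auto simp flip: ennreal_mult ennreal_plus intro!: ennreal_leI)
  also have "\<dots> = ennreal (2 powr s) * (?I g + ?I f)"
    by (simp add: nn_integral_cmult nn_integral_add)
  finally have "weighted_lebesgue_norm s w (\<lambda>x. g x - f x)
      \<le> ennreal_root s (ennreal (2 powr s) * (?I g + ?I f))"
    unfolding weighted_lebesgue_norm_def using assms by (intro ennreal_root_mono) auto
  also have "\<dots> = 2 * ennreal_root s (?I g + ?I f)"
    using assms by (subst ennreal_root_cmult) auto
  also have "\<dots> \<le> 2 * (2 * (ennreal_root s (?I g) + ennreal_root s (?I f)))"
    using assms by (intro mult_left_mono ennreal_root_add_le) auto
  finally show ?thesis
    by (simp add: weighted_lebesgue_norm_def flip: mult.assoc)
qed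

section \<open>Measurability of control functions\<close>

text \<open>By Fatou's lemma each member of the supremum is lower semicontinuous in \<open>\<epsilon>\<close>; the
  countable supremum is what makes control functions with local component
  \<^const>\<open>Grand_Lebesgue\<close> measurable.\<close>

lemma grand_lebesgue_norm_eq_SUP_rat:
  fixes f :: "'a::euclidean_space \<Rightarrow> complex"
  assumes [measurable]: "f \<in> borel_measurable lebesgue" "a \<in> borel_measurable lebesgue"
    and p: "1 < p" and a: "\<And>x. 0 \<le> a x"
  shows "grand_lebesgue_norm p a f =
     (SUP \<epsilon>\<in>{0<..p - 1} \<inter> \<rat>. ennreal \<epsilon> *
        weighted_lebesgue_norm (p - \<epsilon>) (\<lambda>x. a x powr (\<epsilon> / p)) f)" (is "_ = ?S")
proof (rule antisym)
  let ?g = "\<lambda>\<epsilon> x. ennreal (norm (f x) powr (p - \<epsilon>) * a x powr (\<epsilon> / p))"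
  show "grand_lebesgue_norm p a f \<le> ?S"
  proof (cases ?S)
    case top
    then show ?thesis by (simp only: top_greatest)
  next
    case (real M)
    show ?thesis unfolding grand_lebesgue_norm_eq_weighted
    proof (rule SUP_least)
      fix \<epsilon> assume "\<epsilon> \<in> {0<..p - 1}"
      then have e: "0 < \<epsilon>" "\<epsilon> \<le> p - 1" by auto
      \<comment> \<open>Rationals approach \<epsilon> from below, so they never exceed
        \<open>p - 1\<close>, even when \<epsilon> is that endpoint; the maximum with 0 keeps them
        positive.\<close>
      have "\<exists>r\<in>\<rat>. max 0 (\<epsilon> - inverse (real (Suc n))) < r \<and> r < \<epsilon>" for n
        using e by (intro Rats_dense_in_real) auto
      then obtain r where r: "\<And>n. r n \<in> \<rat>"
          "\<And>n. max 0 (\<epsilon> - inverse (real (Suc n))) < r n" "\<And>n. r n < \<epsilon>"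
        by metis
      have r0: "0 < r n" for n using r(2)[of n] by simp
      have rp: "r n \<le> p - 1" for n using r(3)[of n] e by simp
      have "(\<lambda>n. \<epsilon> - inverse (real (Suc n))) \<longlonglongrightarrow> \<epsilon> - 0"
        by (intro tendsto_intros LIMSEQ_inverse_real_of_nat)
      then have lim: "r \<longlonglongrightarrow> \<epsilon>"
        using r by (intro tendsto_sandwich[of "\<lambda>n. \<epsilon> - inverse (real (Suc n))" r _ "\<lambda>_. \<epsilon>"])
          (auto intro!: always_eventually less_imp_le)
      have bound: "(\<integral>\<^sup>+x. ?g (r n) x \<partial>lebesgue) \<le> ennreal ((M / r n) powr (p - r n))" for n
      proof -
        have "ennreal (r n) * ennreal_root (p - r n) (\<integral>\<^sup>+x. ?g (r n) x \<partial>lebesgue) \<le> ?S"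
          using r(1) r0 rp unfolding weighted_lebesgue_norm_def by (intro SUP_upper) auto
        then have "ennreal (inverse (r n)) * (ennreal (r n) *
            ennreal_root (p - r n) (\<integral>\<^sup>+x. ?g (r n) x \<partial>lebesgue)) \<le> ennreal (inverse (r n)) * ennreal M"
          using real by (intro mult_left_mono) auto
        then have "ennreal_root (p - r n) (\<integral>\<^sup>+x. ?g (r n) x \<partial>lebesgue) \<le> ennreal (M / r n)"
          using r0[of n] real
          by (simp add: ennreal_mult[symmetric] divide_inverse mult.commute flip: mult.assoc)
        then show ?thesis
          using r0[of n] r(3)[of n] e real by (subst (asm) ennreal_root_le_iff) auto
      qed
      \<comment> \<open>The bases may vanish, but the limit exponents \<open>p - \<epsilon>\<close>
        and \<open>\<epsilon> / p\<close> are positive, so both powers still converge.\<close>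
      have g: "(\<lambda>n. ?g (r n) x) \<longlonglongrightarrow> ?g \<epsilon> x" for x
        using e p a lim by (intro tendsto_ennrealI tendsto_mult tendsto_powr' tendsto_intros) auto
      have "(\<integral>\<^sup>+x. ?g \<epsilon> x \<partial>lebesgue) = (\<integral>\<^sup>+x. liminf (\<lambda>n. ?g (r n) x) \<partial>lebesgue)"
        using lim_imp_Liminf[OF _ g] by simp
      also have "\<dots> \<le> liminf (\<lambda>n. \<integral>\<^sup>+x. ?g (r n) x \<partial>lebesgue)"
        by (intro nn_integral_liminf) measurable
      also have "\<dots> \<le> liminf (\<lambda>n. ennreal ((M / r n) powr (p - r n)))"
        by (intro Liminf_mono always_eventually allI bound)
      also have "\<dots> = ennreal ((M / \<epsilon>) powr (p - \<epsilon>))"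
        using e p real r0 lim
        by (intro lim_imp_Liminf tendsto_ennrealI tendsto_powr' tendsto_intros)
          (auto intro!: always_eventually less_imp_le)
      finally have "ennreal_root (p - \<epsilon>) (\<integral>\<^sup>+x. ?g \<epsilon> x \<partial>lebesgue) \<le> ennreal (M / \<epsilon>)"
        using e real by (subst ennreal_root_le_iff) auto
      then have "ennreal \<epsilon> * ennreal_root (p - \<epsilon>) (\<integral>\<^sup>+x. ?g \<epsilon> x \<partial>lebesgue)
          \<le> ennreal \<epsilon> * ennreal (M / \<epsilon>)"
        by (intro mult_left_mono) auto
      also have "\<dots> = ?S" using e real by (simp add: ennreal_mult[symmetric])
      finally show "ennreal \<epsilon> * weighted_lebesgue_norm (p - \<epsilon>) (\<lambda>x. a x powr (\<epsilon> / p)) f \<le> ?S"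
        by (simp add: weighted_lebesgue_norm_def)
    qed
  qed
  show "?S \<le> grand_lebesgue_norm p a f"
    unfolding grand_lebesgue_norm_eq_weighted by (intro SUP_subset_mono) auto
qed

text \<open>Tonelli's theorem requires an integrand that is jointly measurable in \<open>x\<close>
  and \<open>y\<close>. Replacing \<open>h\<close> by a Borel function equal to it almost
  everywhere, and the translate of \<open>Q\<close> by the condition \<open>y - x \<in> Q\<close>,
  provides one without changing the integral.\<close>

lemma borel_measurable_nn_integral_translate:
  fixes h :: "'a::euclidean_space \<Rightarrow> ennreal"
  assumes h: "h \<in> borel_measurable lebesgue" and [measurable]: "Q \<in> sets borel"
  shows "(\<lambda>x. \<integral>\<^sup>+y. h y * indicator ((\<lambda>y. y + x) ` Q) y \<partial>lebesgue) \<in> borel_measurable borel"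
proof -
  obtain h' where [measurable]: "h' \<in> borel_measurable lborel" and ae: "AE y in lborel. h y = h' y"
    using completion_ex_borel_measurable[OF h] by blast
  have mem: "y \<in> (\<lambda>y. y + x) ` Q \<longleftrightarrow> y - x \<in> Q" for x y :: 'a
    by (force simp: image_iff algebra_simps)
  have "(\<integral>\<^sup>+y. h y * indicator ((\<lambda>y. y + x) ` Q) y \<partial>lebesgue)
      = (\<integral>\<^sup>+y. h' y * indicator Q (y - x) \<partial>lborel)" for x
  proof -
    have "(\<integral>\<^sup>+y. h y * indicator ((\<lambda>y. y + x) ` Q) y \<partial>lebesgue)
        = (\<integral>\<^sup>+y. h' y * indicator Q (y - x) \<partial>lebesgue)"
      using AE_completion[OF ae]
      by (intro nn_integral_cong_AE) (auto elim!: eventually_mono simp: indicator_def mem)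
    then show ?thesis by (simp add: nn_integral_completion)
  qed
  moreover have "(\<lambda>x. \<integral>\<^sup>+y. h' y * indicator Q (y - x) \<partial>lborel) \<in> borel_measurable borel"
    by (intro lborel.borel_measurable_nn_integral) measurable
  ultimately show ?thesis by simp
qed

lemma borel_measurable_weighted_norm_translate:
  fixes f :: "'a::euclidean_space \<Rightarrow> complex"
  assumes [measurable]: "f \<in> borel_measurable lebesgue" "w \<in> borel_measurable lebesgue"
    and Q: "compact Q" and "0 < s"
  shows "(\<lambda>x. weighted_lebesgue_norm s w (cutoff f ((\<lambda>y. y + x) ` Q))) \<in> borel_measurable borel"
proof -
  have [measurable]: "Q \<in> sets borel" using Q by (intro borel_closed compact_imp_closed)
  \<comment> \<open>Since \<open>0 powr s = 0\<close>, the indicator can be pulled out of the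
    power.\<close>
  have "ennreal (norm (cutoff f K y) powr s * w y)
      = ennreal (norm (f y) powr s * w y) * indicator K y" for K y
    using assms by (auto simp: cutoff_def indicator_def)
  then show ?thesis unfolding weighted_lebesgue_norm_def
    by (simp only:) (intro measurable_compose[OF borel_measurable_nn_integral_translate
      measurable_ennreal_root], measurable)
qed

lemma borel_measurable_cutoff [measurable]:
  fixes f :: "'a::euclidean_space \<Rightarrow> complex"
  assumes [measurable]: "f \<in> borel_measurable lebesgue" and "compact K"
  shows "cutoff f K \<in> borel_measurable lebesgue"
proof -
  have "K \<in> sets lebesgue"
    using assms by (intro sets_completionI_sets) (simp add: borel_closed compact_imp_closed)
  then show ?thesis unfolding cutoff_def by measurable
qed

section \<open>Estimates for all component spaces at once\<close>

text \<open>The conditions are phrased by measurability and nonnegativity so that the powers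
  \<open>a powr (\<epsilon> / p)\<close>, which are the weights of the target spaces in (b), satisfy
  them at once.\<close>

fun admissible :: "'a::euclidean_space function_space \<Rightarrow> bool" where
  "admissible (Lebesgue s) \<longleftrightarrow> 1 \<le> s"
| "admissible (Weighted_Lebesgue s w) \<longleftrightarrow>
     1 \<le> s \<and> w \<in> borel_measurable lebesgue \<and> (\<forall>x. 0 \<le> w x)"
| "admissible (Grand_Lebesgue p a) \<longleftrightarrow>
     1 < p \<and> a \<in> borel_measurable lebesgue \<and> (\<forall>x. 0 \<le> a x)"

text \<open>Solidity of the norms: this carries a pointwise comparison of control functions into the
  outer norm. For the grand norm every member of the supremum obeys the bound with the same
  \<open>c\<close>.\<close>

lemma space_norm_le_cmult:
  assumes "admissible B" and f: "f \<in> borel_measurable lebesgue" and "0 < c"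
    and "\<And>x. norm (h x) \<le> c * norm (f x)"
  shows "space_norm B h \<le> ennreal c * space_norm B f"
proof (cases B)
  case (Grand_Lebesgue p a)
  with assms have [measurable]: "a \<in> borel_measurable lebesgue" by simp
  show ?thesis
    unfolding Grand_Lebesgue space_norm.simps grand_lebesgue_norm_eq_weighted
  proof (rule SUP_least)
    fix \<epsilon> assume e: "\<epsilon> \<in> {0<..p - 1}"
    let ?N = "\<lambda>\<epsilon>. weighted_lebesgue_norm (p - \<epsilon>) (\<lambda>x. a x powr (\<epsilon> / p))"
    have "ennreal \<epsilon> * ?N \<epsilon> h \<le> ennreal \<epsilon> * (ennreal c * ?N \<epsilon> f)"
      using e assms by (intro mult_left_mono weighted_lebesgue_norm_le_cmult) auto
    also have "\<dots> = ennreal c * (ennreal \<epsilon> * ?N \<epsilon> f)" by (simp add: mult.left_commute)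
    also have "\<dots> \<le> ennreal c * (SUP \<epsilon>\<in>{0<..p - 1}. ennreal \<epsilon> * ?N \<epsilon> f)"
      using e by (intro mult_left_mono SUP_upper) auto
    finally show "ennreal \<epsilon> * ?N \<epsilon> h \<le> ennreal c * (SUP \<epsilon>\<in>{0<..p - 1}. ennreal \<epsilon> * ?N \<epsilon> f)" .
  qed
qed (use assms in \<open>auto simp: lebesgue_norm_eq_weighted intro!: weighted_lebesgue_norm_le_cmult\<close>)

text \<open>Serves to show that differences of functions locally in \<open>B\<close> are again
  locally in \<open>B\<close>.\<close>

lemma space_norm_diff_le:
  assumes "admissible B" and f: "f \<in> borel_measurable lebesgue" and g: "g \<in> borel_measurable lebesgue"
  shows "space_norm B (\<lambda>x. g x - f x) \<le> 4 * (space_norm B g + space_norm B f)"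
proof (cases B)
  case (Grand_Lebesgue p a)
  with assms have [measurable]: "a \<in> borel_measurable lebesgue" by simp
  show ?thesis
    unfolding Grand_Lebesgue space_norm.simps grand_lebesgue_norm_eq_weighted
  proof (rule SUP_least)
    fix \<epsilon> assume e: "\<epsilon> \<in> {0<..p - 1}"
    let ?N = "\<lambda>\<epsilon>. weighted_lebesgue_norm (p - \<epsilon>) (\<lambda>x. a x powr (\<epsilon> / p))"
    let ?S = "\<lambda>f. SUP \<epsilon>\<in>{0<..p - 1}. ennreal \<epsilon> * ?N \<epsilon> f"
    have "ennreal \<epsilon> * ?N \<epsilon> (\<lambda>x. g x - f x) \<le> ennreal \<epsilon> * (4 * (?N \<epsilon> g + ?N \<epsilon> f))"
      using e assms by (intro mult_left_mono weighted_lebesgue_norm_diff_le) auto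
    also have "\<dots> = 4 * (ennreal \<epsilon> * ?N \<epsilon> g + ennreal \<epsilon> * ?N \<epsilon> f)"
      by (simp add: algebra_simps)
    also have "\<dots> \<le> 4 * (?S g + ?S f)"
      using e by (intro mult_left_mono add_mono SUP_upper) auto
    finally show "ennreal \<epsilon> * ?N \<epsilon> (\<lambda>x. g x - f x) \<le> 4 * (?S g + ?S f)" .
  qed
qed (use assms in \<open>auto simp: lebesgue_norm_eq_weighted simp del: distrib_left_numeral
      intro!: weighted_lebesgue_norm_diff_le\<close>)

lemma borel_measurable_control:
  assumes B: "admissible B" and f: "f \<in> borel_measurable lebesgue" and Q: "compact Q"
  shows "control Q B f \<in> borel_measurable lebesgue"
proof -
  have "(\<lambda>x. space_norm B (cutoff f ((\<lambda>y. y + x) ` Q))) \<in> borel_measurable borel"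
  proof (cases B)
    case (Grand_Lebesgue p a)
    with B have [measurable]: "a \<in> borel_measurable lebesgue" by simp
    have "compact ((\<lambda>y. y + x) ` Q)" for x
      using Q by (intro compact_continuous_image continuous_intros)
    then have "grand_lebesgue_norm p a (cutoff f ((\<lambda>y. y + x) ` Q)) =
       (SUP \<epsilon>\<in>{0<..p - 1} \<inter> \<rat>. ennreal \<epsilon> * weighted_lebesgue_norm (p - \<epsilon>)
          (\<lambda>x. a x powr (\<epsilon> / p)) (cutoff f ((\<lambda>y. y + x) ` Q)))" for x
      using B f Grand_Lebesgue by (intro grand_lebesgue_norm_eq_SUP_rat borel_measurable_cutoff) auto
    moreover have "(\<lambda>x. weighted_lebesgue_norm (p - \<epsilon>) (\<lambda>x. a x powr (\<epsilon> / p))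
        (cutoff f ((\<lambda>y. y + x) ` Q))) \<in> borel_measurable borel" if "\<epsilon> \<in> {0<..p - 1} \<inter> \<rat>" for \<epsilon>
      using that f Q by (intro borel_measurable_weighted_norm_translate) auto
    ultimately show ?thesis
      unfolding Grand_Lebesgue space_norm.simps
      by (simp only:) (intro borel_measurable_SUP borel_measurable_times_ennreal
        borel_measurable_const countable_Int2 countable_rat)
  qed (use assms in \<open>auto simp: lebesgue_norm_eq_weighted
        intro!: borel_measurable_weighted_norm_translate\<close>)
  then have [measurable]: "(\<lambda>x. space_norm B (cutoff f ((\<lambda>y. y + x) ` Q))) \<in> borel_measurable lebesgue"
    by (intro measurable_completion) simp
  show ?thesis unfolding control_def by measurable
qed

section \<open>From inequalities between components to embeddings of amalgams\<close>

text \<open>The local inequality is applied on each translate of \<open>Q\<close> and passes through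
  the norm of \<open>C\<close> by solidity; the global inequality then replaces \<open>C\<close> by
  \<open>C'\<close>.\<close>

lemma wiener_norm_le:
  assumes Q: "compact Q"
    and adm: "admissible B" "admissible B'" "admissible C" "admissible C'"
    and c: "0 < c" "\<And>f. f \<in> borel_measurable lebesgue \<Longrightarrow> space_norm B' f \<le> ennreal c * space_norm B f"
    and d: "0 < d" "\<And>f. f \<in> borel_measurable lebesgue \<Longrightarrow> space_norm C' f \<le> ennreal d * space_norm C f"
    and f: "f \<in> borel_measurable lebesgue" "\<And>K. compact K \<Longrightarrow> space_norm B (cutoff f K) < \<infinity>"
  shows "wiener_norm Q B' C' f \<le> ennreal (c * d) * wiener_norm Q B C f"
proof -
  have "norm (control Q B' f x) \<le> c * norm (control Q B f x)" for x
  proof -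
    have K: "compact ((\<lambda>y. y + x) ` Q)"
      using Q by (intro compact_continuous_image continuous_intros)
    \<comment> \<open>Monotonicity of \<open>enn2real\<close> requires a finite larger side, since
      \<open>\<infinity>\<close> is sent to 0. This is where local finiteness of \<open>f\<close>
      enters.\<close>
    have "enn2real (space_norm B' (cutoff f ((\<lambda>y. y + x) ` Q)))
        \<le> enn2real (ennreal c * space_norm B (cutoff f ((\<lambda>y. y + x) ` Q)))"
      using K c f by (intro enn2real_mono) (auto simp: ennreal_mult_less_top)
    then show ?thesis using c by (simp add: control_def enn2real_mult)
  qed
  then have "space_norm C (control Q B' f) \<le> ennreal c * space_norm C (control Q B f)"
    using adm f Q c by (intro space_norm_le_cmult borel_measurable_control) auto
  moreover have "space_norm C' (control Q B' f) \<le> ennreal d * space_norm C (control Q B' f)"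
    using adm f Q by (intro d borel_measurable_control)
  ultimately have "space_norm C' (control Q B' f) \<le> ennreal d * (ennreal c * space_norm C (control Q B f))"
    by (meson order_trans mult_left_mono zero_le)
  then show ?thesis
    using c d by (simp add: wiener_norm_def ennreal_mult mult_ac)
qed

text \<open>The norm bound gives the inclusion when applied to \<open>f\<close>, and continuity when
  applied to \<open>g - f\<close>, with \<open>e / (c * d)\<close> compensating the
  constant.\<close>

lemma wiener_embeddingI:
  assumes Q: "compact Q"
    and adm: "admissible B" "admissible B'" "admissible C" "admissible C'"
    and c: "0 < c" "\<And>f. f \<in> borel_measurable lebesgue \<Longrightarrow> space_norm B' f \<le> ennreal c * space_norm B f"
    and d: "0 < d" "\<And>f. f \<in> borel_measurable lebesgue \<Longrightarrow> space_norm C' f \<le> ennreal d * space_norm C f"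
  shows "wiener_embedding Q B C B' C'"
  unfolding wiener_embedding_def continuous_inclusion_def
proof (intro conjI subsetI ballI allI impI)
  note bound = wiener_norm_le[OF Q adm c d]
  fix f assume f: "f \<in> wiener_space Q B C"
  then have fm: "f \<in> borel_measurable lebesgue"
    and fK: "\<And>K. compact K \<Longrightarrow> space_norm B (cutoff f K) < \<infinity>"
    and fC: "wiener_norm Q B C f < \<infinity>"
    by (auto simp: wiener_space_def space_set_def wiener_norm_def)
  show "f \<in> wiener_space Q B' C'"
    unfolding wiener_space_def space_set_def
  proof (safe intro!: fm borel_measurable_cutoff borel_measurable_control adm Q)
    fix K :: "'a set" assume K: "compact K"
    have "space_norm B' (cutoff f K) \<le> ennreal c * space_norm B (cutoff f K)"
      using K fm by (intro c borel_measurable_cutoff)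
    also have "\<dots> < \<infinity>" using fK[OF K] by (simp add: ennreal_mult_less_top)
    finally show "space_norm B' (cutoff f K) < \<infinity>" .
  next
    have "wiener_norm Q B' C' f \<le> ennreal (c * d) * wiener_norm Q B C f"
      by (intro bound fm fK)
    also have "\<dots> < \<infinity>" using fC by (simp add: ennreal_mult_less_top)
    finally show "space_norm C' (control Q B' f) < \<infinity>" by (simp add: wiener_norm_def)
  qed
  fix e :: real assume e: "0 < e"
  show "\<exists>\<delta>>0. \<forall>g\<in>wiener_space Q B C. wiener_norm Q B C (\<lambda>x. g x - f x) < ennreal \<delta> \<longrightarrow>
      wiener_norm Q B' C' (\<lambda>x. g x - f x) < ennreal e"
  proof (intro exI[of _ "e / (c * d)"] conjI ballI impI)
    show "0 < e / (c * d)" using c d e by simp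
    fix g assume g: "g \<in> wiener_space Q B C"
      and small: "wiener_norm Q B C (\<lambda>x. g x - f x) < ennreal (e / (c * d))"
    from g have gm: "g \<in> borel_measurable lebesgue"
      and gK: "\<And>K. compact K \<Longrightarrow> space_norm B (cutoff g K) < \<infinity>"
      by (auto simp: wiener_space_def space_set_def)
    have "wiener_norm Q B' C' (\<lambda>x. g x - f x) \<le> ennreal (c * d) * wiener_norm Q B C (\<lambda>x. g x - f x)"
    proof (rule bound)
      show "(\<lambda>x. g x - f x) \<in> borel_measurable lebesgue" using fm gm by measurable
      fix K :: "'a set" assume K: "compact K"
      \<comment> \<open>The bound applies to \<open>g - f\<close> only once this function is known
        to be locally in \<open>B\<close>; cutting off commutes with subtraction.\<close>
      have "space_norm B (\<lambda>x. cutoff g K x - cutoff f K x)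
          \<le> 4 * (space_norm B (cutoff g K) + space_norm B (cutoff f K))"
        using K fm gm by (intro space_norm_diff_le adm borel_measurable_cutoff)
      also have "\<dots> < \<infinity>" using fK[OF K] gK[OF K] by (simp add: ennreal_mult_less_top)
      finally show "space_norm B (cutoff (\<lambda>x. g x - f x) K) < \<infinity>"
        by (simp add: cutoff_def algebra_simps)
    qed
    also have "\<dots> < ennreal (c * d) * ennreal (e / (c * d))"
      using c d small by (intro ennreal_mult_strict_left_mono) auto
    also have "\<dots> = ennreal e" using c d e by (simp flip: ennreal_mult)
    finally show "wiener_norm Q B' C' (\<lambda>x. g x - f x) < ennreal e" .
  qed
qed

section \<open>Comparison of Lebesgue, grand Lebesgue and weighted Lebesgue norms\<close>

text \<open>After normalising \<open>f\<close> by \<open>M\<close>, the inequality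
  \<open>u powr (p - \<epsilon>) * v powr (\<epsilon> / p) \<le> u powr p + v\<close> replaces Hoelder's inequality.\<close>

lemma weighted_lebesgue_norm_le_lebesgue_norm:
  fixes f :: "'a::euclidean_space \<Rightarrow> complex"
  assumes [measurable]: "f \<in> borel_measurable lebesgue"
    and a: "integrable lebesgue a" "\<And>x. 0 \<le> a x" and e: "0 < \<epsilon>" "\<epsilon> \<le> p - 1"
  shows "weighted_lebesgue_norm (p - \<epsilon>) (\<lambda>x. a x powr (\<epsilon> / p)) f
    \<le> ennreal (1 + integral\<^sup>L lebesgue a) * lebesgue_norm p f"
proof -
  define A where "A = integral\<^sup>L lebesgue a"
  have [measurable]: "a \<in> borel_measurable lebesgue" using a by auto
  have A: "(\<integral>\<^sup>+x. ennreal (a x) \<partial>lebesgue) = ennreal A" "0 \<le> A"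
    unfolding A_def using a by (auto intro!: nn_integral_eq_integral integral_nonneg)
  \<comment> \<open>Working with any positive \<open>M\<close> above the norm, instead of the norm
    itself, permits division by \<open>M\<close> even if the norm is 0.\<close>
  have le: "weighted_lebesgue_norm (p - \<epsilon>) (\<lambda>x. a x powr (\<epsilon> / p)) f \<le> ennreal (1 + A) * ennreal M"
    if M: "0 < M" "lebesgue_norm p f \<le> ennreal M" for M
  proof -
    have fM: "(\<integral>\<^sup>+x. ennreal (norm (f x) powr p) \<partial>lebesgue) \<le> ennreal (M powr p)"
      using M e by (simp add: lebesgue_norm_def ennreal_root_le_iff)
    have pw: "norm (f x) powr (p - \<epsilon>) * a x powr (\<epsilon> / p)
        \<le> M powr (p - \<epsilon>) * (M powr (- p) * norm (f x) powr p + a x)" for x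
    proof -
      define u where "u = norm (f x) / M"
      \<comment> \<open>Both factors are bounded by powers of \<open>m\<close> whose exponents
        \<open>(p - \<epsilon>) / p\<close> and \<open>\<epsilon> / p\<close> add up to 1, so their
        product is at most \<open>m\<close>.\<close>
      define m where "m = max (u powr p) (a x)"
      have u: "0 \<le> u" and fu: "norm (f x) = M * u" using M by (auto simp: u_def)
      have "u powr (p - \<epsilon>) = (u powr p) powr ((p - \<epsilon>) / p)"
        using e by (simp add: powr_powr)
      also have "\<dots> \<le> m powr ((p - \<epsilon>) / p)"
        using e by (intro powr_mono2) (auto simp: m_def)
      finally have "u powr (p - \<epsilon>) * a x powr (\<epsilon> / p) \<le> m powr ((p - \<epsilon>) / p) * m powr (\<epsilon> / p)"
        using e a by (intro mult_mono powr_mono2) (auto simp: m_def)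
      also have "\<dots> = m"
        using e a(2)[of x] by (simp add: m_def flip: powr_add add_divide_distrib)
      also have "\<dots> \<le> u powr p + a x" using a(2)[of x] by (simp add: m_def)
      also have "u powr p = M powr (- p) * norm (f x) powr p"
        using M by (simp add: u_def powr_divide powr_minus_divide)
      finally have "M powr (p - \<epsilon>) * (u powr (p - \<epsilon>) * a x powr (\<epsilon> / p))
          \<le> M powr (p - \<epsilon>) * (M powr (- p) * norm (f x) powr p + a x)"
        by (intro mult_left_mono) auto
      then show ?thesis using M u by (simp add: fu powr_mult mult.assoc)
    qed
    have "(\<integral>\<^sup>+x. ennreal (norm (f x) powr (p - \<epsilon>) * a x powr (\<epsilon> / p)) \<partial>lebesgue)
        \<le> (\<integral>\<^sup>+x. ennreal (M powr (p - \<epsilon>)) * (ennreal (M powr (- p)) * ennreal (norm (f x) powr p)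
              + ennreal (a x)) \<partial>lebesgue)"
      using pw a by (intro nn_integral_mono)
        (auto simp flip: ennreal_mult ennreal_plus intro!: ennreal_leI)
    also have "\<dots> = ennreal (M powr (p - \<epsilon>)) * (ennreal (M powr (- p)) *
          (\<integral>\<^sup>+x. ennreal (norm (f x) powr p) \<partial>lebesgue) + ennreal A)"
      by (simp add: nn_integral_cmult nn_integral_add A)
    also have "\<dots> \<le> ennreal (M powr (p - \<epsilon>)) * (ennreal (M powr (- p)) * ennreal (M powr p) + ennreal A)"
      using fM by (intro mult_left_mono add_mono) auto
    also have "\<dots> = ennreal (M powr (p - \<epsilon>) * (1 + A))"
      using M A by (simp add: powr_minus ennreal_mult flip: ennreal_mult')
    \<comment> \<open>Enlarging \<open>1 + A\<close> to its power of exponent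
      \<open>p - \<epsilon> \<ge> 1\<close> lets the root return exactly \<open>1 + A\<close>, a
      constant independent of \<epsilon>.\<close>
    also have "\<dots> \<le> ennreal (M powr (p - \<epsilon>) * (1 + A) powr (p - \<epsilon>))"
      using powr_mono[of 1 "p - \<epsilon>" "1 + A"] A e
      by (intro ennreal_leI mult_left_mono) auto
    also have "\<dots> = ennreal (((1 + A) * M) powr (p - \<epsilon>))"
      using M A by (simp add: powr_mult mult.commute)
    finally have "weighted_lebesgue_norm (p - \<epsilon>) (\<lambda>x. a x powr (\<epsilon> / p)) f \<le> ennreal ((1 + A) * M)"
      unfolding weighted_lebesgue_norm_def using M A e by (subst ennreal_root_le_iff) auto
    then show ?thesis using M A by (subst ennreal_mult[symmetric]) auto
  qed
  have "weighted_lebesgue_norm (p - \<epsilon>) (\<lambda>x. a x powr (\<epsilon> / p)) f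
    \<le> ennreal (1 + A) * lebesgue_norm p f"
  proof (cases "lebesgue_norm p f")
    case (real N)
    show ?thesis
    \<comment> \<open>Now \<open>M\<close> tends to the norm \<open>N\<close>: the excess
      \<open>\<delta> / (1 + A)\<close> becomes \<delta> after multiplication by the
      constant.\<close>
    proof (rule ennreal_le_epsilon)
      fix \<delta> :: real assume "0 < \<delta>"
      then have "0 < \<delta> / (1 + A)" using A by simp
      then have "weighted_lebesgue_norm (p - \<epsilon>) (\<lambda>x. a x powr (\<epsilon> / p)) f
          \<le> ennreal (1 + A) * ennreal (N + \<delta> / (1 + A))"
        using real by (intro le) (auto intro!: ennreal_leI)
      also have "\<dots> = ennreal (1 + A) * lebesgue_norm p f + ennreal \<delta>"
        using real A \<open>0 < \<delta>\<close>
        by (simp add: distrib_left del: ennreal_plus flip: ennreal_mult ennreal_plus)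
      finally show "weighted_lebesgue_norm (p - \<epsilon>) (\<lambda>x. a x powr (\<epsilon> / p)) f
          \<le> ennreal (1 + A) * lebesgue_norm p f + ennreal \<delta>" .
    qed
  qed (use A in \<open>simp add: ennreal_mult_top\<close>)
  then show ?thesis by (simp add: A_def)
qed

text \<open>The prefactor \<epsilon> is at most \<open>p - 1\<close>, and the preceding estimate of
  the members is uniform in \<epsilon>, so the supremum inherits the product of the two
  constants.\<close>

lemma grand_lebesgue_norm_le_lebesgue_norm:
  fixes f :: "'a::euclidean_space \<Rightarrow> complex"
  assumes "f \<in> borel_measurable lebesgue"
    and "integrable lebesgue a" "\<And>x. 0 \<le> a x" and "1 < p"
  shows "grand_lebesgue_norm p a f
    \<le> ennreal ((p - 1) * (1 + integral\<^sup>L lebesgue a)) * lebesgue_norm p f"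
  unfolding grand_lebesgue_norm_eq_weighted
proof (rule SUP_least)
  fix \<epsilon> assume e: "\<epsilon> \<in> {0<..p - 1}"
  have "0 \<le> integral\<^sup>L lebesgue a" using assms by (simp add: integral_nonneg)
  moreover have "ennreal \<epsilon> * weighted_lebesgue_norm (p - \<epsilon>) (\<lambda>x. a x powr (\<epsilon> / p)) f
      \<le> ennreal (p - 1) * (ennreal (1 + integral\<^sup>L lebesgue a) * lebesgue_norm p f)"
    using e assms by (intro mult_mono weighted_lebesgue_norm_le_lebesgue_norm ennreal_leI) auto
  ultimately show "ennreal \<epsilon> * weighted_lebesgue_norm (p - \<epsilon>) (\<lambda>x. a x powr (\<epsilon> / p)) f
      \<le> ennreal ((p - 1) * (1 + integral\<^sup>L lebesgue a)) * lebesgue_norm p f"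
    using assms by (simp add: ennreal_mult mult.assoc)
qed

text \<open>The factor \<open>inverse \<epsilon>\<close> cancels the prefactor of the member of the
  supremum with index \<epsilon>.\<close>

lemma weighted_lebesgue_norm_le_grand_lebesgue_norm:
  assumes "0 < \<epsilon>" "\<epsilon> \<le> p - 1"
  shows "weighted_lebesgue_norm (p - \<epsilon>) (\<lambda>x. a x powr (\<epsilon> / p)) f
    \<le> ennreal (inverse \<epsilon>) * grand_lebesgue_norm p a f"
proof -
  let ?N = "weighted_lebesgue_norm (p - \<epsilon>) (\<lambda>x. a x powr (\<epsilon> / p)) f"
  have "?N = ennreal (inverse \<epsilon>) * (ennreal \<epsilon> * ?N)"
    using assms by (simp flip: ennreal_mult mult.assoc)
  also have "\<dots> \<le> ennreal (inverse \<epsilon>) * grand_lebesgue_norm p a f"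
    unfolding grand_lebesgue_norm_eq_weighted
    using assms by (intro mult_left_mono SUP_upper) auto
  finally show ?thesis .
qed

section \<open>The two embeddings\<close>

theorem theorem3p2:
  fixes Q :: "(real ^ 'n) set" and p q :: real and a b :: "real ^ 'n \<Rightarrow> real"
  assumes "compact Q" and "interior Q \<noteq> {}"
    and "1 < p" and "1 < q"
    and "weight a" and "weight b"
    and "integrable lebesgue a" and "integrable lebesgue b"
  shows "(wiener_embedding Q (Lebesgue p) (Lebesgue q) (Grand_Lebesgue p a) (Grand_Lebesgue q b) \<and>
          (\<exists>C::real. C > 0 \<and>
             (\<forall>f \<in> wiener_space Q (Lebesgue p) (Lebesgue q).
                wiener_norm Q (Grand_Lebesgue p a) (Grand_Lebesgue q b) f
                  \<le> ennreal C * wiener_norm Q (Lebesgue p) (Lebesgue q) f))) \<and>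
         (\<forall>\<epsilon> \<eta>. 0 < \<epsilon> \<and> \<epsilon> \<le> p - 1 \<and> 0 < \<eta> \<and> \<eta> \<le> q - 1 \<longrightarrow>
            wiener_embedding Q (Grand_Lebesgue p a) (Grand_Lebesgue q b)
              (Weighted_Lebesgue (p - \<epsilon>) (\<lambda>x. a x powr (\<epsilon> / p)))
              (Weighted_Lebesgue (q - \<eta>) (\<lambda>x. b x powr (\<eta> / q))))"
proof -
  have a: "a \<in> borel_measurable lebesgue" "\<And>x. 0 \<le> a x"
    and b: "b \<in> borel_measurable lebesgue" "\<And>x. 0 \<le> b x"
    using assms by (auto simp: weight_def)
  let ?c = "(p - 1) * (1 + integral\<^sup>L lebesgue a)" and ?d = "(q - 1) * (1 + integral\<^sup>L lebesgue b)"
  have pos: "0 < ?c" "0 < ?d"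
    using assms a b by (auto intro!: mult_pos_pos add_pos_nonneg integral_nonneg)
  have adm: "admissible (Lebesgue p)" "admissible (Lebesgue q)"
      "admissible (Grand_Lebesgue p a)" "admissible (Grand_Lebesgue q b)"
    using assms a b by auto
  have c: "space_norm (Grand_Lebesgue p a) f \<le> ennreal ?c * space_norm (Lebesgue p) f"
    and d: "space_norm (Grand_Lebesgue q b) f \<le> ennreal ?d * space_norm (Lebesgue q) f"
    if "f \<in> borel_measurable lebesgue" for f
    using that assms a b by (auto intro!: grand_lebesgue_norm_le_lebesgue_norm)
  show ?thesis
  proof (intro conjI allI impI)
    show "wiener_embedding Q (Lebesgue p) (Lebesgue q) (Grand_Lebesgue p a) (Grand_Lebesgue q b)"
      using assms(1) adm pos c d by (intro wiener_embeddingI)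
    show "\<exists>C::real. C > 0 \<and> (\<forall>f \<in> wiener_space Q (Lebesgue p) (Lebesgue q).
        wiener_norm Q (Grand_Lebesgue p a) (Grand_Lebesgue q b) f
          \<le> ennreal C * wiener_norm Q (Lebesgue p) (Lebesgue q) f)"
    proof (intro exI[of _ "?c * ?d"] conjI ballI)
      show "0 < ?c * ?d" using pos by (rule mult_pos_pos)
      \<comment> \<open>Membership in the amalgam supplies the measurability and local finiteness
        that \<open>wiener_norm_le\<close> requires.\<close>
      fix f assume "f \<in> wiener_space Q (Lebesgue p) (Lebesgue q)"
      then show "wiener_norm Q (Grand_Lebesgue p a) (Grand_Lebesgue q b) f
          \<le> ennreal (?c * ?d) * wiener_norm Q (Lebesgue p) (Lebesgue q) f"
        using assms(1) adm pos c d
        by (intro wiener_norm_le) (auto simp: wiener_space_def space_set_def)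
    qed
  next
    fix \<epsilon> \<eta> :: real assume e: "0 < \<epsilon> \<and> \<epsilon> \<le> p - 1 \<and> 0 < \<eta> \<and> \<eta> \<le> q - 1"
    have [measurable]: "a \<in> borel_measurable lebesgue" "b \<in> borel_measurable lebesgue"
      by (fact a b)+
    show "wiener_embedding Q (Grand_Lebesgue p a) (Grand_Lebesgue q b)
        (Weighted_Lebesgue (p - \<epsilon>) (\<lambda>x. a x powr (\<epsilon> / p)))
        (Weighted_Lebesgue (q - \<eta>) (\<lambda>x. b x powr (\<eta> / q)))"
    \<comment> \<open>The constants invert the prefactors \<epsilon> and \<eta> of the chosen
      members; the upper bounds on \<epsilon> and \<eta> make the exponents
      \<open>p - \<epsilon>\<close> and \<open>q - \<eta>\<close> at least 1, as admissibility
      demands.\<close>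
    proof (rule wiener_embeddingI[where c = "inverse \<epsilon>" and d = "inverse \<eta>"])
    qed (use assms(1) adm e in \<open>auto intro!: weighted_lebesgue_norm_le_grand_lebesgue_norm\<close>)
  qed
qed

end
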